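(* If $T$ is a finite tree with exactly two centers, then the eccentric graph $ecc(T)$ is isomorphic to some coclique extension of the path $P_4$ on four vertices.
   Context: For a connected graph $G=(V,E)$, $d_G(u,v)$ is the minimum number of edges of a path from $u$ to $v$. The eccentricity of a vertex $u$ is $ecc(u)=\max_{v\in V} d_G(u,v)$. The radius is the minimum eccentricity, and a center of $G$ is a vertex whose eccentricity equals the radius. Every tree has either one or two centers. The eccentric graph $ecc(G)$ is the simple graph with vertex set $V$ in which two distinct vertices $u,v$ are adjacent if and only if $d_G(u,v)=ecc(u)$ or $d_G(u,v)=ecc(v)$ (distances and eccentricities taken in $G$). Let $H$ be a graph with vertices $1,\dots,n$. A coclique extension of $H$ is a graph whose vertex set is the union of mutually disjoint nonempty finite sets $V_1,\dots,V_n$, such that the vertices within each $V_i$ are pairwise non-adjacent, and for $i\ne j$ a vertex of $V_i$ and a vertex of $V_j$ are adjacent if and only if $i$ and $j$ are adjacent in $H$.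
   Formalization: The tree T is also required to have more than two vertices: the single-edge tree has two centers, but its eccentric graph has only two vertices, while a coclique extension of P_4 has at least four; this is the only tree excluded. *)

theory Defs
  imports "Graph_Theory.Graph_Theory" "HOL-Library.Disjoint_Sets"
begin

text \<open>
  A finite simple graph is a \<^locale>\<open>pair_graph\<close>: a finite vertex set with a symmetric,
  irreflexive set of ordered pairs of vertices as its arcs.  The edge
  \<open>{u, v}\<close> is represented by the two arcs \<open>(u, v)\<close> and \<open>(v, u)\<close>.
\<close>

text \<open>
  The library's \<^const>\<open>forest\<close> and \<^const>\<open>tree\<close> count the closed walk \<open>u, v, u\<close> along the two
  arcs of one edge as a cycle, so no symmetric graph with an edge is a \<^const>\<open>tree\<close>.  A cycle of an
  undirected graph is a \<^const>\<open>pre_digraph.cycle\<close> of length at least 3.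
\<close>

definition undirected_tree :: "'a pair_pre_digraph \<Rightarrow> bool" where
  "undirected_tree G \<longleftrightarrow> pair_graph G \<and> connected (with_proj G) \<and>
     \<not> (\<exists>p. pre_digraph.cycle (with_proj G) p \<and> length p \<ge> 3)"

text \<open>The next four notions are meaningful for finite connected nonempty graphs only.\<close>

definition graph_dist :: "'a pair_pre_digraph \<Rightarrow> 'a \<Rightarrow> 'a \<Rightarrow> nat" where
  "graph_dist G u v = (LEAST n. \<exists>p. pre_digraph.apath (with_proj G) u p v \<and> length p = n)"

definition eccentricity :: "'a pair_pre_digraph \<Rightarrow> 'a \<Rightarrow> nat" where
  "eccentricity G u = Max (graph_dist G u ` pverts G)"

definition radius :: "'a pair_pre_digraph \<Rightarrow> nat" where
  "radius G = Min (eccentricity G ` pverts G)"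

definition centers :: "'a pair_pre_digraph \<Rightarrow> 'a set" where
  "centers G = {u \<in> pverts G. eccentricity G u = radius G}"

definition eccentric_graph :: "'a pair_pre_digraph \<Rightarrow> 'a pair_pre_digraph" where
  "eccentric_graph G =
     \<lparr>pverts = pverts G,
      parcs = {(u, v). u \<in> pverts G \<and> v \<in> pverts G \<and> u \<noteq> v \<and>
                 (graph_dist G u v = eccentricity G u \<or> graph_dist G u v = eccentricity G v)}\<rparr>"

definition path_graph :: "nat \<Rightarrow> nat pair_pre_digraph" where
  "path_graph n =
     \<lparr>pverts = {1..n},
      parcs = {(i, j). i \<in> {1..n} \<and> j \<in> {1..n} \<and> (j = i + 1 \<or> i = j + 1)}\<rparr>"

definition coclique_extension :: "'i pair_pre_digraph \<Rightarrow> 'a pair_pre_digraph \<Rightarrow> bool" where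
  "coclique_extension H K \<longleftrightarrow> pair_graph K \<and>
     (\<exists>V. pverts K = (\<Union>i\<in>pverts H. V i) \<and>
          disjoint_family_on V (pverts H) \<and>
          (\<forall>i\<in>pverts H. V i \<noteq> {} \<and> finite (V i)) \<and>
          (\<forall>i\<in>pverts H. \<forall>u\<in>V i. \<forall>v\<in>V i. (u, v) \<notin> parcs K) \<and>
          (\<forall>i\<in>pverts H. \<forall>j\<in>pverts H. i \<noteq> j \<longrightarrow>
             (\<forall>u\<in>V i. \<forall>v\<in>V j. (u, v) \<in> parcs K \<longleftrightarrow> (i, j) \<in> parcs H)))"

text \<open>
  All parts \<open>V i\<close> are nonempty, so a coclique extension of the path on four vertices has at least
  four vertices.  The tree with one edge has two centers and is its own eccentric graph; it is
  therefore a counterexample to the claim that the eccentric graph of every tree with two centers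
  is such an extension, and must be excluded by requiring more than two vertices.
\<close>

end

theory Submission
  imports Defs
begin

text \<open>
  Let \<open>x\<close> and \<open>y\<close> be the two centers and \<open>R\<close> the radius.  In a tree every edge is a bridge
  (lemma \<open>tree_edge_separates\<close>), so distances between the two sides of an edge \<open>xb\<close> are
  additive: \<open>d(u,v) = d(u,x) + 1 + d(b,v)\<close>.

  Apply this to the first edge \<open>xb\<close> on a shortest path from \<open>x\<close> to \<open>y\<close>.  As \<open>ecc(y) = R\<close>, every
  vertex on the side of \<open>x\<close> is within \<open>R - 1 - d(b,y)\<close> of \<open>x\<close>, and as \<open>ecc(x) = R\<close>, every vertex
  on the other side is within \<open>R - 1\<close> of \<open>b\<close>.  If \<open>b\<close> were different from \<open>y\<close>, then
  \<open>ecc(b) < R\<close>, which is impossible.  So the centers are adjacent, and the same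
  inequalities show that both sides have the same depth \<open>r = R - 1\<close>, measured from \<open>x\<close> and from
  \<open>y\<close> respectively (lemma \<open>two_centers_split\<close>).

  Hence the vertices farthest from a vertex \<open>u\<close> on one side are exactly the vertices of depth \<open>r\<close>
  on the other side.  Two vertices are thus adjacent in the eccentric graph if and only if they
  lie on different sides and at least one of them has depth \<open>r\<close>.  Listing the
  shallow vertices beside \<open>x\<close>, the deepest beside \<open>y\<close>, the deepest beside \<open>x\<close> and the shallow ones
  beside \<open>y\<close>, in this order, exhibits the eccentric graph itself as a coclique extension of the
  path on four vertices.  The parts of shallow vertices contain \<open>x\<close> and \<open>y\<close> as soon as \<open>r > 0\<close>,
  and \<open>r = 0\<close> would leave only the two centers.
\<close>

section \<open>Distances in a finite connected graph\<close>

locale connected_pair_graph = pair_graph G for G :: "'a pair_pre_digraph" +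
  assumes connected_graph: "connected (with_proj G)"
begin

abbreviation d where "d \<equiv> graph_dist G"

text \<open>
  Since the distance is a minimum over paths without repeated vertices while
  concatenation only produces walks, the next two lemmas let walks serve in its place.
\<close>

lemma graph_dist_le_awalk:
  assumes "awalk u p v"
  shows "d u v \<le> length p"
proof -
  let ?q = "awalk_to_apath p"
  have q: "apath u ?q v"
    using apath_awalk_to_apath[OF assms] .
  then have "distinct ?q"
    unfolding apath_def using distinct_verts_imp_distinct by blast
  then have "length ?q \<le> length p"
    by (metis awalk_to_apath_subset[OF assms] List.finite_set card_length card_mono
        distinct_card le_trans)
  moreover have "d u v \<le> length ?q"
    unfolding graph_dist_def by (rule Least_le) (use q in blast)
  ultimately show ?thesis by simp
qed

lemma obtain_shortest_awalk:
  assumes "u \<in> pverts G" "v \<in> pverts G"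
  obtains p where "awalk u p v" "length p = d u v"
proof -
  have "strongly_connected (with_proj G)"
    using symmetric_connected_imp_strongly_connected[OF pair_sym_arcs connected_graph] .
  then have "u \<rightarrow>\<^sup>*\<^bsub>with_proj G\<^esub> v"
    using assms by (auto elim: strongly_connectedE)
  then have "\<exists>n p. apath u p v \<and> length p = n"
    by (simp add: reachable_apath)
  then have "\<exists>p. apath u p v \<and> length p = d u v"
    unfolding graph_dist_def by (rule LeastI_ex)
  then show ?thesis
    using that by (auto simp: apath_def)
qed

lemma graph_dist_triangle:
  assumes "u \<in> pverts G" "v \<in> pverts G" "w \<in> pverts G"
  shows "d u w \<le> d u v + d v w"
proof -
  obtain p q where "awalk u p v" "length p = d u v" "awalk v q w" "length q = d v w"
    using assms obtain_shortest_awalk by metis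
  then show ?thesis
    using graph_dist_le_awalk[of u "p @ q" w] by (auto intro: awalk_appendI)
qed

lemma graph_dist_sym:
  assumes "u \<in> pverts G" "v \<in> pverts G"
  shows "d u v = d v u"
proof -
  have le: "d y x \<le> d x y" if xy: "x \<in> pverts G" "y \<in> pverts G" for x y
  proof -
    obtain p where p: "awalk x p y" "length p = d x y"
      using obtain_shortest_awalk xy by metis
    have "length (rev_path p) = length p"
      by (induct p) auto
    then show ?thesis
      using graph_dist_le_awalk[of y "rev_path p" x] p by simp
  qed
  show ?thesis
    using le[OF assms] le[OF assms(2,1)] by simp
qed

lemma graph_dist_self: "u \<in> pverts G \<Longrightarrow> d u u = 0"
  using graph_dist_le_awalk[of u "[]" u] by (simp add: awalk_Nil_iff)

lemma graph_dist_pos: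
  assumes "u \<in> pverts G" "v \<in> pverts G" "u \<noteq> v"
  shows "0 < d u v"
proof -
  obtain p where p: "awalk u p v" "length p = d u v"
    using obtain_shortest_awalk assms by metis
  then show ?thesis
    using assms(3) by (cases p) (auto simp: awalk_Nil_iff)
qed

lemma obtain_closer_neighbour:
  assumes "u \<in> pverts G" "v \<in> pverts G" "u \<noteq> v"
  obtains b where "(u, b) \<in> parcs G" "d b v < d u v"
proof -
  obtain p where p: "awalk u p v" "length p = d u v"
    using obtain_shortest_awalk assms by metis
  then obtain e q where pe: "p = e # q"
    using assms(3) by (cases p) (auto simp: awalk_Nil_iff)
  then have "fst e = u" "e \<in> parcs G" "awalk (snd e) q v"
    using p by (auto simp: awalk_Cons_iff)
  then show ?thesis
    using that[of "snd e"] graph_dist_le_awalk[of "snd e" q v] p pe by (cases e) auto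
qed

lemma graph_dist_le_eccentricity: "v \<in> pverts G \<Longrightarrow> d u v \<le> eccentricity G u"
  unfolding eccentricity_def using pair_finite_verts by simp

lemma obtain_eccentric_vertex:
  assumes "u \<in> pverts G"
  obtains v where "v \<in> pverts G" "d u v = eccentricity G u"
proof -
  have "eccentricity G u \<in> d u ` pverts G"
    unfolding eccentricity_def by (rule Max_in) (use assms pair_finite_verts in auto)
  then show ?thesis using that by auto
qed

lemma radius_le_eccentricity: "u \<in> pverts G \<Longrightarrow> radius G \<le> eccentricity G u"
  unfolding radius_def using pair_finite_verts by simp

end

section \<open>Edges of a tree are bridges\<close>

locale finite_tree = connected_pair_graph G for G :: "'a pair_pre_digraph" +
  assumes no_long_cycle: "\<not> (\<exists>p. cycle p \<and> length p \<ge> 3)"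

lemma finite_tree_iff: "finite_tree G \<longleftrightarrow> undirected_tree G"
  unfolding undirected_tree_def finite_tree_def finite_tree_axioms_def
    connected_pair_graph_def connected_pair_graph_axioms_def
  by blast

context finite_tree
begin

text \<open>
  A walk from \<open>a\<close> to \<open>b\<close> avoiding the arc \<open>(a, b)\<close> would contain a path of length
  at least 2, which the arc \<open>(b, a)\<close> closes to a cycle of length at least 3.
\<close>
lemma awalk_across_edge_uses_edge:
  assumes ab: "(a, b) \<in> parcs G" and p: "awalk a p b"
  shows "(a, b) \<in> set p"
proof (rule ccontr)
  assume notin: "(a, b) \<notin> set p"
  let ?q = "awalk_to_apath p"
  have q: "awalk a ?q b" "distinct (awalk_verts a ?q)"
    using apath_awalk_to_apath[OF p] by (auto simp: apath_def)
  have q_notin: "(a, b) \<notin> set ?q"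
    using notin awalk_to_apath_subset[OF p] by blast
  have "a \<noteq> b"
    using no_loops'[OF ab] .
  have len: "2 \<le> length ?q"
  proof (rule ccontr)
    assume "\<not> 2 \<le> length ?q"
    then consider "?q = []" | e where "?q = [e]"
      by (cases ?q; cases "tl ?q") auto
    then show False
      using q(1) q_notin \<open>a \<noteq> b\<close> by cases (auto simp: awalk_simps)
  qed
  have ba: "awalk b [(b, a)] a"
    using arcs_symmetric[OF ab] by (auto simp: awalk_simps in_arcsD1 in_arcsD2)
  have closed: "awalk a (?q @ [(b, a)]) a"
    using q(1) ba by (rule awalk_appendI)
  have verts: "awalk_verts a (?q @ [(b, a)]) = awalk_verts a ?q @ [a]"
    using awalk_verts_append[OF closed] q(1) by auto
  have "awalk_verts a ?q = a # tl (awalk_verts a ?q)"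
    using q(1) by (metis awalkE awalk_verts_non_Nil list.collapse)
  then have "distinct (tl (awalk_verts a ?q) @ [a])"
    using q(2) by (metis distinct.simps(2) distinct_append distinct_singleton
        disjoint_insert(2) inf_bot_right list.set(1) list.simps(15))
  then have "distinct (tl (awalk_verts a (?q @ [(b, a)])))"
    unfolding verts by simp
  then have "cycle (?q @ [(b, a)])"
    unfolding cycle_def using closed by blast
  then show False
    using no_long_cycle len by fastforce
qed

text \<open>
  The set \<open>A\<close> is the component of \<open>a\<close> after deletion of the edge: \<open>(a, b)\<close> is the only arc
  leaving it, so every walk from \<open>A\<close> to its complement passes through \<open>a\<close> and then \<open>b\<close>.
\<close>
lemma tree_edge_separates:
  assumes ab: "(a, b) \<in> parcs G"
  obtains A where "A \<subseteq> pverts G" "a \<in> A" "b \<in> pverts G - A"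
    "\<And>u v. u \<in> A \<Longrightarrow> v \<in> pverts G - A \<Longrightarrow> d u v = Suc (d u a + d b v)"
proof -
  define A where "A = {u. \<exists>p. awalk a p u \<and> (a, b) \<notin> set p}"
  have a: "a \<in> pverts G" and b: "b \<in> pverts G"
    using ab by (auto dest: in_arcsD1 in_arcsD2)
  have sub: "A \<subseteq> pverts G"
    unfolding A_def by (auto dest: awalk_last_in_verts)
  have aA: "a \<in> A"
    unfolding A_def using a by (auto simp: awalk_Nil_iff intro!: exI[of _ "[]"])
  have bA: "b \<notin> A"
    unfolding A_def using awalk_across_edge_uses_edge[OF ab] by auto
  have leave: "(x, y) = (a, b)" if "(x, y) \<in> parcs G" "x \<in> A" "y \<notin> A" for x y
  proof (rule ccontr)
    assume neq: "(x, y) \<noteq> (a, b)"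
    obtain p where p: "awalk a p x" "(a, b) \<notin> set p"
      using \<open>x \<in> A\<close> unfolding A_def by blast
    have "awalk x [(x, y)] y"
      using that(1) by (auto simp: awalk_simps in_arcsD1 in_arcsD2)
    then have "awalk a (p @ [(x, y)]) y"
      using p(1) by (metis awalk_appendI)
    moreover have "(a, b) \<notin> set (p @ [(x, y)])"
      using p(2) neq by auto
    ultimately show False
      using \<open>y \<notin> A\<close> unfolding A_def by blast
  qed
  have split: "\<exists>p1 p2. p = p1 @ (a, b) # p2 \<and> awalk u p1 a \<and> awalk b p2 v"
    if "awalk u p v" "u \<in> A" "v \<notin> A" for u p v
    using that
  proof (induct p arbitrary: u)
    case Nil
    then show ?case by (auto simp: awalk_Nil_iff)
  next
    case (Cons e p)
    obtain w where e: "e = (u, w)" "(u, w) \<in> parcs G" "awalk w p v"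
      using Cons.prems(1) by (cases e) (auto simp: awalk_Cons_iff)
    show ?case
    proof (cases "w \<in> A")
      case True
      then obtain p1 p2 where "p = p1 @ (a, b) # p2" "awalk w p1 a" "awalk b p2 v"
        using Cons.hyps[OF e(3)] Cons.prems(3) by blast
      then show ?thesis
        using e by (intro exI[of _ "e # p1"] exI[of _ p2])
          (auto simp: awalk_Cons_iff in_arcsD1)
    next
      case False
      then have "u = a" "w = b"
        using leave[OF e(2) Cons.prems(2)] by auto
      then show ?thesis
        using e a by (intro exI[of _ "[]"] exI[of _ p]) (auto simp: awalk_Nil_iff)
    qed
  qed
  have "d u v = Suc (d u a + d b v)" if u: "u \<in> A" and v: "v \<in> pverts G - A" for u v
  proof (rule antisym)
    have uG: "u \<in> pverts G" using sub u by blast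
    obtain p where p: "awalk u p v" "length p = d u v"
      using obtain_shortest_awalk uG v by blast
    obtain p1 p2 where "p = p1 @ (a, b) # p2" "awalk u p1 a" "awalk b p2 v"
      using split[OF p(1) u] v by blast
    then show "Suc (d u a + d b v) \<le> d u v"
      using p(2) graph_dist_le_awalk[of u p1 a] graph_dist_le_awalk[of b p2 v] by simp
    have "d a b \<le> 1"
      using graph_dist_le_awalk[of a "[(a, b)]" b] ab a b by (simp add: awalk_simps)
    moreover have "d u v \<le> d u a + d a v" "d a v \<le> d a b + d b v"
      using graph_dist_triangle uG a b v by auto
    ultimately show "d u v \<le> Suc (d u a + d b v)" by simp
  qed
  then show ?thesis
    using that[of A] sub aA b bA by blast
qed

section \<open>Trees with two centers\<close>

text \<open>
  If the first edge \<open>xb\<close> towards \<open>y\<close> did not end in \<open>y\<close>, then \<open>b\<close> would have smaller eccentricity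
  than both centers.  Once \<open>b = y\<close>, each side has depth at most \<open>radius - 1\<close> because of the center
  on the other side, and the depth is attained because the eccentric vertices of a
  center cannot lie on its own side.
\<close>
lemma two_centers_split:
  assumes x: "x \<in> centers G" and y: "y \<in> centers G" and "x \<noteq> y"
  obtains A r where "A \<subseteq> pverts G" "x \<in> A" "y \<in> pverts G - A"
    "\<And>u v. u \<in> A \<Longrightarrow> v \<in> pverts G - A \<Longrightarrow> d u v = Suc (d u x + d y v)"
    "\<And>u. u \<in> A \<Longrightarrow> d u x \<le> r" "\<exists>u\<in>A. d u x = r"
    "\<And>v. v \<in> pverts G - A \<Longrightarrow> d y v \<le> r" "\<exists>v\<in>pverts G - A. d y v = r"
proof -
  let ?R = "radius G"
  have xG: "x \<in> pverts G" and yG: "y \<in> pverts G"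
    and ex: "eccentricity G x = ?R" and ey: "eccentricity G y = ?R"
    using x y unfolding centers_def by auto
  obtain b where b: "(x, b) \<in> parcs G" "d b y < d x y"
    using obtain_closer_neighbour xG yG \<open>x \<noteq> y\<close> by blast
  obtain A where A: "A \<subseteq> pverts G" "x \<in> A" "b \<in> pverts G - A"
    and dist: "\<And>u v. u \<in> A \<Longrightarrow> v \<in> pverts G - A \<Longrightarrow> d u v = Suc (d u x + d b v)"
    using tree_edge_separates[OF b(1)] by metis
  have xx: "d x x = 0" and bb: "d b b = 0"
    using graph_dist_self xG A by auto
  \<comment> \<open>Otherwise the path from \<open>y\<close> to \<open>b\<close> would pass through \<open>x\<close>, but \<open>b\<close> is closer to \<open>y\<close>.\<close>
  have yA: "y \<in> pverts G - A"
  proof (rule ccontr)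
    assume "y \<notin> pverts G - A"
    then have "d y b = Suc (d y x)"
      using dist[of y b] A bb yG by simp
    then show False
      using b(2) graph_dist_sym[of y b] graph_dist_sym[of y x] yG xG A by simp
  qed
  have nearA: "Suc (d u x + d b y) \<le> ?R" if "u \<in> A" for u
    using dist[OF that yA] graph_dist_le_eccentricity[of u y] graph_dist_sym[of u y]
      ey that A yG by auto
  have nearB: "Suc (d b v) \<le> ?R" if "v \<in> pverts G - A" for v
    using dist[OF A(2) that] graph_dist_le_eccentricity[of v x] ex xx that by auto
  have by_eq: "b = y"
  proof (rule ccontr)
    assume "b \<noteq> y"
    then have pos: "0 < d b y"
      using graph_dist_pos A yG by blast
    obtain w where w: "w \<in> pverts G" "d b w = eccentricity G b"
      using obtain_eccentric_vertex A by blast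
    have "d b w < ?R"
    proof (cases "w \<in> A")
      case True
      then show ?thesis
        using nearA[OF True] dist[OF True A(3)] bb pos graph_dist_sym[of w b] w A by auto
    next
      case False
      then show ?thesis using nearB[of w] w by auto
    qed
    then show False
      using w radius_le_eccentricity[of b] A by auto
  qed
  have yy: "d y y = 0" using bb by_eq by simp
  have R: "0 < ?R" using nearA[OF A(2)] by simp
  have "\<exists>v\<in>pverts G - A. d y v = ?R - 1"
  proof -
    obtain w where w: "w \<in> pverts G" "d x w = ?R"
      using obtain_eccentric_vertex[OF xG] ex by metis
    have "w \<notin> A"
      using nearA[of w] graph_dist_sym[of x w] w xG by auto
    then show ?thesis
      using dist[OF A(2), of w] w xx by_eq by (intro bexI[of _ w]) auto
  qed
  moreover have "\<exists>u\<in>A. d u x = ?R - 1"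
  proof -
    obtain w where w: "w \<in> pverts G" "d y w = ?R"
      using obtain_eccentric_vertex[OF yG] ey by metis
    have "w \<in> A"
      using nearB[of w] w by_eq by auto
    then show ?thesis
      using dist[OF _ A(3), of w] w yy by_eq graph_dist_sym[of y w] yG
      by (intro bexI[of _ w]) auto
  qed
  moreover have "d u x \<le> ?R - 1" if "u \<in> A" for u
    using nearA[OF that] by simp
  moreover have "d y v \<le> ?R - 1" if "v \<in> pverts G - A" for v
    using nearB[OF that] by_eq by simp
  ultimately show ?thesis
    using that[of A "?R - 1"] A dist by_eq by blast
qed

end

section \<open>Eccentric graphs and coclique extensions\<close>

lemma (in pair_graph) pair_graph_eccentric_graph: "pair_graph (eccentric_graph G)"
proof -
  let ?E = "eccentric_graph G"
  have sym: "graph_dist G u v = graph_dist G v u" for u v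
  proof -
    have "(\<exists>p. apath u p v \<and> length p = n) \<longleftrightarrow> (\<exists>p. apath v p u \<and> length p = n)" for n
    proof -
      have "length (rev_path p) = length p" for p :: "('a \<times> 'a) awalk"
        by (induct p) auto
      then show ?thesis
        by (metis apath_rev_path)
    qed
    then show ?thesis unfolding graph_dist_def by simp
  qed
  have fin: "finite (parcs ?E)"
    by (rule finite_subset[of _ "pverts G \<times> pverts G"])
      (auto simp: eccentric_graph_def pair_finite_verts)
  have "symmetric (with_proj ?E)"
    unfolding symmetric_def by (rule symI) (auto simp: eccentric_graph_def sym)
  then show ?thesis
    using fin by unfold_locales (auto simp: eccentric_graph_def pair_finite_verts)
qed

lemma digraph_iso_refl:
  assumes "wf_digraph G"
  shows "digraph_iso G G"
proof -
  let ?h = "\<lparr>iso_verts = id, iso_arcs = id, iso_head = head G, iso_tail = tail G\<rparr>"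
  have "pre_digraph.digraph_isomorphism G ?h"
    unfolding pre_digraph.digraph_isomorphism_def using assms by simp
  moreover have "G = app_iso ?h G"
    by (simp add: app_iso_def)
  ultimately show ?thesis
    unfolding digraph_iso_def by blast
qed

text \<open>
  The four parts are \<open>A - P\<close>, \<open>Q\<close>, \<open>P\<close> and \<open>B - Q\<close>, in the order of the path; in the eccentric graph
  of a tree, \<open>P\<close> and \<open>Q\<close> consist of the deepest vertices of the two sides \<open>A\<close> and \<open>B\<close>.
\<close>
lemma coclique_extension_path4I:
  assumes K: "pair_graph K"
    and AB: "pverts K = A \<union> B" "A \<inter> B = {}"
    and P: "P \<subset> A" "P \<noteq> {}" and Q: "Q \<subset> B" "Q \<noteq> {}"
    and A: "\<And>u v. u \<in> A \<Longrightarrow> v \<in> A \<Longrightarrow> (u, v) \<notin> parcs K"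
    and B: "\<And>u v. u \<in> B \<Longrightarrow> v \<in> B \<Longrightarrow> (u, v) \<notin> parcs K"
    and adj: "\<And>u v. u \<in> A \<Longrightarrow> v \<in> B \<Longrightarrow> (u, v) \<in> parcs K \<longleftrightarrow> u \<in> P \<or> v \<in> Q"
  shows "coclique_extension (path_graph 4) K"
proof -
  interpret K: pair_graph K by (rule K)
  have adj': "(v, u) \<in> parcs K \<longleftrightarrow> u \<in> P \<or> v \<in> Q" if "u \<in> A" "v \<in> B" for u v
    using adj[OF that] K.arcs_symmetric by blast
  have PA: "u \<in> A" if "u \<in> P" for u using that P by auto
  have QB: "v \<in> B" if "v \<in> Q" for v using that Q by auto
  define V where "V = (\<lambda>i::nat. if i = 1 then A - P else if i = 2 then Q
    else if i = 3 then P else B - Q)"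
  have V: "V 1 = A - P" "V (Suc 0) = A - P" "V 2 = Q" "V 3 = P" "V 4 = B - Q"
    unfolding V_def by auto
  have vs: "pverts (path_graph 4) = {1, 2, 3, 4}"
    unfolding path_graph_def by auto
  have arcs: "(i, j) \<in> parcs (path_graph 4) \<longleftrightarrow>
      i \<in> {1, 2, 3, 4} \<and> j \<in> {1, 2, 3, 4} \<and> (j = i + 1 \<or> i = j + 1)" for i j
    unfolding path_graph_def by auto
  have "finite A" "finite B"
    using K.pair_finite_verts AB by auto
  then have fin: "finite P" "finite Q" "finite (A - P)" "finite (B - Q)"
    using P Q by (auto intro: finite_subset)
  show ?thesis
    unfolding coclique_extension_def
  proof (intro conjI exI[of _ V])
    show "pverts K = (\<Union>i\<in>pverts (path_graph 4). V i)"
      unfolding vs using AB P Q by (auto simp: V)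
    show "disjoint_family_on V (pverts (path_graph 4))"
      unfolding vs disjoint_family_on_def using AB P Q by (auto simp: V)
    show "\<forall>i\<in>pverts (path_graph 4). V i \<noteq> {} \<and> finite (V i)"
      unfolding vs using P Q fin by (auto simp: V)
    show "\<forall>i\<in>pverts (path_graph 4). \<forall>u\<in>V i. \<forall>v\<in>V i. (u, v) \<notin> parcs K"
      unfolding vs using PA QB A B by (auto simp: V)
    show "\<forall>i\<in>pverts (path_graph 4). \<forall>j\<in>pverts (path_graph 4). i \<noteq> j \<longrightarrow>
        (\<forall>u\<in>V i. \<forall>v\<in>V j. (u, v) \<in> parcs K \<longleftrightarrow> (i, j) \<in> parcs (path_graph 4))"
      unfolding vs arcs by (auto simp: V PA QB A B adj adj')
  qed (rule K)
qed

text \<open>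
  With the two sides \<open>A\<close>, \<open>B\<close> and their common depth \<open>r\<close>, a vertex \<open>u\<close> of \<open>A\<close> has eccentricity
  \<open>d(u,x) + 1 + r\<close>.  A vertex of its own side is within \<open>d(u,x) + r\<close>, and a vertex \<open>v\<close> of \<open>B\<close>
  attains the eccentricity exactly when \<open>d(y,v) = r\<close>; symmetrically for \<open>B\<close>.
\<close>
theorem lemma2p5:
  fixes T :: "'a pair_pre_digraph"
  assumes "undirected_tree T"
    and "card (centers T) = 2"
    and "card (pverts T) > 2"
  shows "\<exists>K :: 'a pair_pre_digraph. coclique_extension (path_graph 4) K \<and>
           digraph_iso (with_proj (eccentric_graph T)) (with_proj K)"
proof -
  interpret T: finite_tree T
    using assms(1) by (simp add: finite_tree_iff)
  let ?d = "graph_dist T" and ?e = "eccentricity T" and ?E = "eccentric_graph T"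
  obtain x y where xy: "x \<in> centers T" "y \<in> centers T" "x \<noteq> y"
    using assms(2) by (auto simp: card_2_iff)
  obtain A r where A: "A \<subseteq> pverts T" "x \<in> A" "y \<in> pverts T - A"
    and dist: "\<And>u v. u \<in> A \<Longrightarrow> v \<in> pverts T - A \<Longrightarrow> ?d u v = Suc (?d u x + ?d y v)"
    and deepA: "\<And>u. u \<in> A \<Longrightarrow> ?d u x \<le> r" "\<exists>u\<in>A. ?d u x = r"
    and deepB: "\<And>v. v \<in> pverts T - A \<Longrightarrow> ?d y v \<le> r" "\<exists>v\<in>pverts T - A. ?d y v = r"
    by (fact T.two_centers_split[OF xy])
  define B where "B = pverts T - A"
  note dist = dist[folded B_def] and deepB = deepB[folded B_def]
  have AB: "pverts T = A \<union> B" "A \<inter> B = {}" and yB: "y \<in> B"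
    using A unfolding B_def by auto
  have xx: "?d x x = 0" and yy: "?d y y = 0"
    using T.graph_dist_self A by auto
  have r: "0 < r"
  proof -
    have "\<not> pverts T \<subseteq> {x, y}"
    proof
      assume "pverts T \<subseteq> {x, y}"
      then have "card (pverts T) \<le> card {x, y}" by (intro card_mono) auto
      then show False using assms(3) xy(3) by simp
    qed
    then obtain w where w: "w \<in> pverts T" "w \<noteq> x" "w \<noteq> y" by auto
    show ?thesis
    proof (cases "w \<in> A")
      case True
      then show ?thesis
        using T.graph_dist_pos[of w x] deepA(1)[of w] w A by fastforce
    next
      case False
      then show ?thesis
        using T.graph_dist_pos[of y w] deepB(1)[of w] w AB yB by fastforce
    qed
  qed
  have sameA: "?d u v \<le> ?d u x + r" if "u \<in> A" "v \<in> A" for u v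
    using T.graph_dist_triangle[of u x v] T.graph_dist_sym[of x v] deepA(1)[of v] that A by fastforce
  have sameB: "?d u v \<le> ?d y u + r" if "u \<in> B" "v \<in> B" for u v
    using T.graph_dist_triangle[of u y v] T.graph_dist_sym[of y u] deepB(1)[of v] that AB yB
    by fastforce
  have dist': "?d v u = Suc (?d u x + ?d y v)" if "u \<in> A" "v \<in> B" for u v
    using dist[OF that] T.graph_dist_sym[of u v] that AB by auto
  have eA: "?e u = Suc (?d u x + r)" if u: "u \<in> A" for u
  proof (rule antisym)
    obtain w where w: "w \<in> pverts T" "?d u w = ?e u"
      using T.obtain_eccentric_vertex u A by blast
    show "?e u \<le> Suc (?d u x + r)"
    proof (cases "w \<in> A")
      case True
      then show ?thesis using sameA[OF u True] w by simp
    next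
      case False
      then show ?thesis using dist[OF u, of w] deepB(1)[of w] w AB by auto
    qed
    obtain v where "v \<in> B" "?d y v = r"
      using deepB(2) by blast
    then show "Suc (?d u x + r) \<le> ?e u"
      using dist[OF u, of v] T.graph_dist_le_eccentricity[of v u] AB(1) by simp
  qed
  have eB: "?e v = Suc (?d y v + r)" if v: "v \<in> B" for v
  proof (rule antisym)
    obtain w where w: "w \<in> pverts T" "?d v w = ?e v"
      using T.obtain_eccentric_vertex v AB by blast
    show "?e v \<le> Suc (?d y v + r)"
    proof (cases "w \<in> A")
      case True
      then show ?thesis using dist'[OF True v] deepA(1)[OF True] w by simp
    next
      case False
      then show ?thesis using sameB[OF v, of w] w AB by auto
    qed
    obtain u where "u \<in> A" "?d u x = r"
      using deepA(2) by blast
    then show "Suc (?d y v + r) \<le> ?e v"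
      using dist'[OF _ v, of u] T.graph_dist_le_eccentricity[of u v] AB(1) by simp
  qed
  have E: "pair_graph ?E" by (rule T.pair_graph_eccentric_graph)
  have "coclique_extension (path_graph 4) ?E"
  proof (rule coclique_extension_path4I[OF E])
    let ?P = "{u \<in> A. ?d u x = r}" and ?Q = "{v \<in> B. ?d y v = r}"
    show "pverts ?E = A \<union> B" "A \<inter> B = {}"
      using AB by (auto simp: eccentric_graph_def)
    have "x \<notin> ?P" "y \<notin> ?Q"
      using xx yy r by auto
    then show "?P \<subset> A" "?Q \<subset> B"
      using A(2) yB by blast+
    show "?P \<noteq> {}" "?Q \<noteq> {}"
      using deepA(2) deepB(2) by auto
    show "(u, v) \<notin> parcs ?E" if "u \<in> A" "v \<in> A" for u v
      using sameA[OF that] sameA[OF that(2,1)] T.graph_dist_sym[of u v] eA that A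
      by (auto simp: eccentric_graph_def)
    show "(u, v) \<notin> parcs ?E" if "u \<in> B" "v \<in> B" for u v
      using sameB[OF that] sameB[OF that(2,1)] T.graph_dist_sym[of u v] eB that AB
      by (auto simp: eccentric_graph_def)
    show "(u, v) \<in> parcs ?E \<longleftrightarrow> u \<in> ?P \<or> v \<in> ?Q" if "u \<in> A" "v \<in> B" for u v
      using dist[OF that] eA[OF that(1)] eB[OF that(2)] that AB
      by (auto simp: eccentric_graph_def)
  qed
  moreover have "wf_digraph (with_proj ?E)"
    using E by (simp add: wf_digraph_wp_iff pair_graph_def pair_digraph_def pair_fin_digraph_def)
  ultimately show ?thesis
    using digraph_iso_refl by blast
qed

end
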